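(* Let $m,n$ be arbitrary positive integers, let $A,B\in\mathbb{C}^{m\times n}$, and let $M\in\mathbb{C}^{m\times m}$ be hermitian positive definite. Then $$|\det(A^*MB)|^2\leq \det(A^*MA)\cdot\det(B^*MB).\qquad(\star)$$ Moreover: 1. If $m<n$, equality holds in $(\star)$, both sides vanishing there. 2. If $m=n$, equality holds in $(\star)$. 3. (a) If $m>n$ and $\operatorname{rank}(A)<n$ or $\operatorname{rank}(B)<n$, equality holds in $(\star)$, both sides vanishing there. (b) If $m>n$ and $\operatorname{rank}(A)=\operatorname{rank}(B)=n$, equality holds in $(\star)$ if and only if the columns of $A$ and the columns of $B$ span the same subspace of $\mathbb{C}^m$.
   Context: For a complex matrix $X$, $X^*$ denotes its conjugate transpose. *)

theory Defs
  imports
    "Jordan_Normal_Form.Schur_Decomposition"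
    "Jordan_Normal_Form.DL_Rank"
begin

definition hermitian_mat :: "complex mat \<Rightarrow> bool" where
  "hermitian_mat M \<longleftrightarrow> mat_adjoint M = M"

text \<open>
  The orders on \<^typ>\<open>complex\<close> are those of \<^theory>\<open>HOL-Library.Complex_Order\<close>: \<open>x \<le> y\<close> and
  \<open>x < y\<close> include \<open>Im x = Im y\<close>, so \<open>0 < z\<close> means that \<open>z\<close> is real and positive.  The product
  \<open>(M *\<^sub>v v) \<bullet>c v\<close> conjugates its second argument, so it is \<open>v\<^sup>* M v\<close>.
\<close>

definition hermitian_pos_def :: "nat \<Rightarrow> complex mat \<Rightarrow> bool" where
  "hermitian_pos_def m M \<longleftrightarrow> M \<in> carrier_mat m m \<and> hermitian_mat M \<and>
     (\<forall>v \<in> carrier_vec m. v \<noteq> 0\<^sub>v m \<longrightarrow> 0 < (M *\<^sub>v v) \<bullet>c v)"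

end

theory Submission
  imports Defs
begin

text \<open>When \<open>A\<close> and \<open>B\<close> have full column rank, put \<open>P = A\<^sup>* M A\<close>, \<open>C = A\<^sup>* M B\<close>, \<open>Q = B\<^sup>* M B\<close> and
  \<open>X = P\<^sup>-\<^sup>1 C\<close>, so that \<open>A X\<close> is the \<open>M\<close>-orthogonal projection of \<open>B\<close> to the column space of \<open>A\<close>.
  By Pythagoras the Gram matrix \<open>H\<close> of \<open>A X\<close> satisfies \<open>H \<le> Q\<close> as hermitian forms, and
  \<open>\<bar>det C\<bar>\<^sup>2 = det P \<cdot> det H\<close>.  The eigenvalues of \<open>Q\<^sup>-\<^sup>1 H\<close> lie in \<open>[0, 1]\<close>, whence \<open>det H \<le> det Q\<close>.
  In case of equality they are all \<open>1\<close>; as \<open>Q\<^sup>-\<^sup>1 H\<close> is self-adjoint for the form \<open>Q\<close>, it is then the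
  identity, so \<open>H = Q\<close> and \<open>B = A X\<close>.\<close>

section \<open>Adjoints and the sesquilinear pairing\<close>

lemma mult_mat_unit_vec:
  fixes A :: "'a :: semiring_1 mat"
  assumes "A \<in> carrier_mat m n" "j < n"
  shows "A *\<^sub>v unit_vec n j = col A j"
  using assms by (intro eq_vecI) (auto simp: scalar_prod_right_unit)

lemma mult_mat_zero_vec:
  fixes A :: "'a :: semiring_0 mat"
  assumes "A \<in> carrier_mat m n"
  shows "A *\<^sub>v 0\<^sub>v n = 0\<^sub>v m"
  using assms by (intro eq_vecI) auto

lemma mat_adjoint_carrier [simp]:
  "A \<in> carrier_mat m n \<Longrightarrow> mat_adjoint A \<in> carrier_mat n m"
  unfolding mat_adjoint_def by auto

lemma mat_adjoint_dim [simp]: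
  "dim_row (mat_adjoint A) = dim_col A" "dim_col (mat_adjoint A) = dim_row A"
  unfolding mat_adjoint_def by auto

lemma mat_adjoint_index [simp]:
  "i < dim_col A \<Longrightarrow> j < dim_row A \<Longrightarrow> mat_adjoint A $$ (i, j) = conjugate (A $$ (j, i))"
  unfolding mat_adjoint_def by (simp add: mat_of_rows_index)

lemma mat_adjoint_adjoint [simp]: "mat_adjoint (mat_adjoint A) = A"
  by (rule eq_matI) auto

lemma mat_adjoint_mult:
  assumes "A \<in> carrier_mat m n" "B \<in> carrier_mat n k"
  shows "mat_adjoint (A * B) = mat_adjoint B * mat_adjoint A"
proof (rule eq_matI)
  fix i j
  assume ij: "i < dim_row (mat_adjoint B * mat_adjoint A)" "j < dim_col (mat_adjoint B * mat_adjoint A)"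
  then show "mat_adjoint (A * B) $$ (i, j) = (mat_adjoint B * mat_adjoint A) $$ (i, j)"
    using assms
    by (simp add: scalar_prod_def sum_conjugate conjugate_dist_mul mult.commute)
qed (use assms in auto)

lemma det_mat_adjoint:
  fixes A :: "complex mat"
  assumes "A \<in> carrier_mat n n"
  shows "det (mat_adjoint A) = cnj (det A)"
proof -
  interpret cnj: comm_ring_hom cnj by unfold_locales auto
  have "mat_adjoint A = map_mat cnj (transpose_mat A)"
    by (rule eq_matI) auto
  then show ?thesis
    using assms by (simp add: det_transpose)
qed

lemma mat_adjoint_mult_vec_cscalar_prod:
  fixes A :: "'a :: conjugatable_field mat"
  assumes A: "A \<in> carrier_mat m n" and x: "x \<in> carrier_vec m" and y: "y \<in> carrier_vec n"
  shows "(mat_adjoint A *\<^sub>v x) \<bullet>c y = x \<bullet>c (A *\<^sub>v y)"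
proof -
  have "(mat_adjoint A *\<^sub>v x) \<bullet>c y
      = (\<Sum>i<n. (\<Sum>j<m. conjugate (A $$ (j, i)) * x $ j) * conjugate (y $ i))"
    using assms by (simp add: scalar_prod_def atLeast0LessThan)
  also have "\<dots> = (\<Sum>j<m. \<Sum>i<n. conjugate (A $$ (j, i)) * x $ j * conjugate (y $ i))"
    by (simp add: sum_distrib_right) (rule sum.swap)
  also have "\<dots> = x \<bullet>c (A *\<^sub>v y)"
    using assms
    by (simp add: scalar_prod_def atLeast0LessThan sum_conjugate conjugate_dist_mul
        sum_distrib_left ac_simps)
  finally show ?thesis .
qed

lemma hermitian_form_swap:
  fixes M :: "complex mat"
  assumes M: "M \<in> carrier_mat m m" "mat_adjoint M = M"
    and x: "x \<in> carrier_vec m" and y: "y \<in> carrier_vec m"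
  shows "(M *\<^sub>v x) \<bullet>c y = cnj ((M *\<^sub>v y) \<bullet>c x)"
proof -
  have "(M *\<^sub>v x) \<bullet>c y = x \<bullet>c (M *\<^sub>v y)"
    using mat_adjoint_mult_vec_cscalar_prod[OF M(1) x y] M(2) by simp
  also have "\<dots> = cnj ((M *\<^sub>v y) \<bullet>c x)"
    using M(1) x y by (simp add: scalar_prod_def mult.commute)
  finally show ?thesis .
qed

section \<open>Rank and kernel\<close>

lemma (in vec_space) rank_eq_card_lin_indpt:
  assumes A: "A \<in> carrier_mat n nc"
  obtains S where "S \<subseteq> set (cols A)" "lin_indpt S" "rank A = card S"
proof -
  \<comment> \<open>The columns form a finite set, so a maximal independent subset exists; its size
    is the rank.\<close>
  obtain S where S: "maximal S (\<lambda>T. T \<subseteq> set (cols A) \<and> lin_indpt T)"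
    using maximal_exists[of "\<lambda>T. T \<subseteq> set (cols A) \<and> lin_indpt T" "card (set (cols A))" "{}"]
    by (meson List.finite_set card_mono empty_iff empty_subsetI finite_lin_indpt2 rev_finite_subset)
  then show thesis
    using that[of S] rank_card_indpt[OF A S] unfolding maximal_def by blast
qed

text \<open>Linear dependence concerns the set of columns and does not see repetitions, hence the
  case split. With distinct columns, kernel vectors are dependence relations. If columns
  \<open>i\<close> and \<open>j\<close> coincide, both sides are true: the difference of two unit
  vectors lies in the kernel, and fewer than \<open>n\<close> distinct columns bound the
  rank.\<close>

lemma rank_less_iff_kernel:
  fixes A :: "'a :: field mat"
  assumes A: "A \<in> carrier_mat m n"
  shows "vec_space.rank m A < n \<longleftrightarrow> (\<exists>v \<in> carrier_vec n. v \<noteq> 0\<^sub>v n \<and> A *\<^sub>v v = 0\<^sub>v m)"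
proof -
  interpret vec_space "TYPE('a)" m .
  show ?thesis
  proof (cases "distinct (cols A)")
    case True
    show ?thesis
    proof
      assume "rank A < n"
      then have "lin_dep (set (cols A))"
        using lin_indpt_full_rank[OF A True] by auto
      then show "\<exists>v \<in> carrier_vec n. v \<noteq> 0\<^sub>v n \<and> A *\<^sub>v v = 0\<^sub>v m"
        using lin_depE[OF A _ True] by metis
    next
      assume "\<exists>v \<in> carrier_vec n. v \<noteq> 0\<^sub>v n \<and> A *\<^sub>v v = 0\<^sub>v m"
      then have "lin_dep (set (cols A))"
        using lin_depI[OF A _ _ _ True] by auto
      then show "rank A < n"
        using full_rank_lin_indpt[OF A _ True] rank_le_nc[OF A] by fastforce
    qed
  next
    case False
    then obtain i j where ij: "i < n" "j < n" "i \<noteq> j" "col A i = col A j"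
      using A by (auto simp: distinct_conv_nth)
    have "A *\<^sub>v (unit_vec n i - unit_vec n j) = 0\<^sub>v m"
      using A ij by (simp add: mult_minus_distrib_mat_vec mult_mat_unit_vec)
    moreover have "(unit_vec n i - unit_vec n j :: 'a vec) \<noteq> 0\<^sub>v n"
    proof
      assume "(unit_vec n i - unit_vec n j :: 'a vec) = 0\<^sub>v n"
      then have "(unit_vec n i - unit_vec n j :: 'a vec) $ i = 0\<^sub>v n $ i" by simp
      then show False using ij by simp
    qed
    moreover have "rank A < n"
    proof -
      obtain S where "S \<subseteq> set (cols A)" "rank A = card S"
        by (rule rank_eq_card_lin_indpt[OF A])
      then have "rank A \<le> card (set (cols A))"
        by (simp add: card_mono)
      also have "\<dots> < n"
        using False A card_distinct[of "cols A"] card_length[of "cols A"] by (auto simp: le_less)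
      finally show ?thesis .
    qed
    ultimately show ?thesis
      by (metis minus_carrier_vec unit_vec_carrier)
  qed
qed

lemma rank_le_dim:
  fixes A :: "'a :: field mat"
  assumes A: "A \<in> carrier_mat m n"
  shows "vec_space.rank m A \<le> m"
proof -
  interpret vec_space "TYPE('a)" m .
  obtain S where S: "S \<subseteq> set (cols A)" "lin_indpt S" "rank A = card S"
    by (rule rank_eq_card_lin_indpt[OF A])
  then have "S \<subseteq> carrier_vec m"
    using A cols_dim by blast
  then have "card S \<le> m"
    using li_le_dim(2)[OF fin_dim _ S(2)] dim_is_n by simp
  then show ?thesis
    using S by simp
qed

section \<open>Triangular form, eigenvalues and positivity\<close>

lemma complex_triangularization:
  fixes A :: "complex mat"
  assumes A: "A \<in> carrier_mat n n"
  obtains B P Q where "similar_mat_wit A B P Q" "upper_triangular B"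
    "\<And>e. e \<in> set (diag_mat B) \<Longrightarrow> eigenvalue A e" "det A = prod_list (diag_mat B)"
proof -
  \<comment> \<open>Over the complex numbers the characteristic polynomial splits; a Schur
    decomposition puts its roots \<open>es\<close> on the diagonal.\<close>
  obtain es where es: "char_poly A = (\<Prod>a\<leftarrow>es. [:- a, 1:])"
    using char_poly_factorized[OF A] by blast
  obtain B P Q where dec: "schur_decomposition A es = (B, P, Q)"
    by (cases "schur_decomposition A es") auto
  have B: "similar_mat_wit A B P Q" "upper_triangular B" "diag_mat B = es"
    using schur_decomposition[OF A es dec] by auto
  have "eigenvalue A e" if "e \<in> set es" for e
    unfolding eigenvalue_root_char_poly[OF A] es poly_prod_list
    using that by (auto simp: prod_list_zero_iff image_iff)
  moreover have "det A = prod_list es"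
    using det_similar[of A B] det_upper_triangular[OF B(2)] similar_mat_witD2(5)[OF A B(1)] B
    unfolding similar_mat_def by metis
  ultimately show thesis
    using that[OF B(1,2)] B(3) by simp
qed

lemma prod_list_complex_pos:
  fixes es :: "complex list"
  assumes "\<And>e. e \<in> set es \<Longrightarrow> 0 < e"
  shows "0 < prod_list es"
  using assms by (induction es) (auto simp: less_complex_def)

text \<open>The last clause serves the equality case: a product of numbers in \<open>[0, 1]\<close>
  is at most each factor, so it can be \<open>1\<close> only if all factors are. Comparison with
  \<open>0\<close> forces an entry to be real, so the induction runs on the real parts
  \<open>a\<close> and \<open>p\<close>.\<close>

lemma prod_list_complex_le_1:
  fixes es :: "complex list"
  assumes "\<And>e. e \<in> set es \<Longrightarrow> 0 \<le> e \<and> e \<le> 1"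
  shows "0 \<le> prod_list es \<and> prod_list es \<le> 1 \<and> (prod_list es = 1 \<longrightarrow> (\<forall>e \<in> set es. e = 1))"
  using assms
proof (induction es)
  case (Cons e es)
  define a p where "a = Re e" and "p = Re (prod_list es)"
  have a: "e = complex_of_real a" "0 \<le> a" "a \<le> 1"
    using Cons.prems[of e] by (auto simp: a_def less_eq_complex_def complex_eq_iff)
  have IH: "0 \<le> prod_list es" "prod_list es \<le> 1" "prod_list es = 1 \<Longrightarrow> \<forall>e \<in> set es. e = 1"
    using Cons.IH[OF Cons.prems] by auto
  have p: "prod_list es = complex_of_real p" "0 \<le> p" "p \<le> 1"
    using IH by (auto simp: p_def less_eq_complex_def complex_eq_iff)
  have "a = 1 \<and> p = 1" if "a * p = 1"
  proof -
    have "a * p \<le> a" "a * p \<le> p"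
      using a p by (simp_all add: mult_left_le mult_right_le_one_le mult_left_le_one_le)
    then show ?thesis
      using a p that by simp
  qed
  then show ?case
    using a p IH(3) mult_le_one[of a p]
    by (auto simp: less_eq_complex_def simp flip: of_real_mult)
qed (simp add: less_eq_complex_def)

text \<open>Applying \<open>Q\<close> to \<open>N v = e v\<close> gives \<open>H v = e Q v\<close>.
  Where the form \<open>Q\<close> is positive, \<open>e\<close> is thus a quotient of two form
  values, so inequalities between forms become bounds on eigenvalues.\<close>

lemma eigenvalue_hermitian_form:
  fixes H Q N :: "complex mat"
  assumes "H \<in> carrier_mat n n" "Q \<in> carrier_mat n n" "N \<in> carrier_mat n n"
    and "Q * N = H" and "eigenvalue N e"
  obtains v where "v \<in> carrier_vec n" "v \<noteq> 0\<^sub>v n" "(H *\<^sub>v v) \<bullet>c v = e * ((Q *\<^sub>v v) \<bullet>c v)"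
proof -
  obtain v where v: "v \<in> carrier_vec n" "v \<noteq> 0\<^sub>v n" "N *\<^sub>v v = e \<cdot>\<^sub>v v"
    using assms unfolding eigenvalue_def eigenvector_def by auto
  have "H *\<^sub>v v = Q *\<^sub>v (N *\<^sub>v v)"
    using assms v by (metis assoc_mult_mat_vec)
  also have "\<dots> = e \<cdot>\<^sub>v (Q *\<^sub>v v)"
    using assms v by (simp add: mult_mat_vec)
  finally show thesis
    using that v assms(2) by (simp add: smult_scalar_prod_distrib[of _ n])
qed

lemma det_pos:
  fixes Q :: "complex mat"
  assumes Q: "Q \<in> carrier_mat n n"
    and pos: "\<And>v. v \<in> carrier_vec n \<Longrightarrow> v \<noteq> 0\<^sub>v n \<Longrightarrow> 0 < (Q *\<^sub>v v) \<bullet>c v"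
  shows "0 < det Q"
proof -
  obtain B P P' where B: "\<And>e. e \<in> set (diag_mat B) \<Longrightarrow> eigenvalue Q e"
    "det Q = prod_list (diag_mat B)"
    using complex_triangularization[OF Q] by metis
  have "0 < e" if e: "eigenvalue Q e" for e
  proof -
    \<comment> \<open>With the identity as reference form, \<open>e\<close> is a Rayleigh quotient
      of \<open>Q\<close>.\<close>
    obtain v where v: "v \<in> carrier_vec n" "v \<noteq> 0\<^sub>v n"
      "(Q *\<^sub>v v) \<bullet>c v = e * ((1\<^sub>m n *\<^sub>v v) \<bullet>c v)"
      using eigenvalue_hermitian_form[OF Q one_carrier_mat Q _ e] Q by auto
    have "0 < v \<bullet>c v" "0 < e * (v \<bullet>c v)"
      using v pos[OF v(1,2)] by auto
    then show ?thesis
      by (auto simp: less_complex_def zero_less_mult_iff)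
  qed
  then show ?thesis
    using B prod_list_complex_pos by metis
qed

text \<open>The columns of the strictly triangular \<open>B - 1\<close> vanish one after the other: when the first
  \<open>j\<close> of them do, \<open>B - 1\<close> kills its own column \<open>j\<close>.\<close>

lemma semisimple_unipotent:
  fixes N :: "'a :: comm_ring_1 mat"
  assumes N: "N \<in> carrier_mat n n"
    and sim: "similar_mat_wit N B P P'" and ut: "upper_triangular B"
    and diag: "\<And>e. e \<in> set (diag_mat B) \<Longrightarrow> e = 1"
    and semisimple: "\<And>w. w \<in> carrier_vec n \<Longrightarrow> (N - 1\<^sub>m n) *\<^sub>v ((N - 1\<^sub>m n) *\<^sub>v w) = 0\<^sub>v n \<Longrightarrow>
      (N - 1\<^sub>m n) *\<^sub>v w = 0\<^sub>v n"
  shows "N = 1\<^sub>m n"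
proof -
  note PB = similar_mat_witD2[OF N sim]
  define D T where "D = N - 1\<^sub>m n" and "T = B - 1\<^sub>m n"
  have D: "D \<in> carrier_mat n n" and T: "T \<in> carrier_mat n n"
    unfolding D_def T_def using PB by auto
  \<comment> \<open>\<open>P\<close> intertwines \<open>T\<close> with \<open>D\<close>, so the
    semisimplicity assumed for \<open>D\<close> passes to \<open>T\<close>, where the triangular
    shape can be used.\<close>
  have "P * T = P * B - P"
    unfolding T_def using PB by (simp add: mult_minus_distrib_mat)
  also have "P * B = N * P"
    using assoc_mult_mat[OF mult_carrier_mat[OF PB(6,5)] PB(7,6)] PB(2,3,5,6) by simp
  also have "N * P - P = D * P"
    unfolding D_def using minus_mult_distrib_mat[OF N one_carrier_mat PB(6)] PB(6) by simp
  finally have PT: "P *\<^sub>v (T *\<^sub>v v) = D *\<^sub>v (P *\<^sub>v v)" if "v \<in> carrier_vec n" for v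
    using PB(6) T D that by (metis assoc_mult_mat_vec)
  have P_inj: "v = 0\<^sub>v n" if "v \<in> carrier_vec n" "P *\<^sub>v v = 0\<^sub>v n" for v
  proof -
    have "v = P' *\<^sub>v (P *\<^sub>v v)"
      using assoc_mult_mat_vec[OF PB(7,6) that(1)] PB(2) that(1) by simp
    then show ?thesis
      using PB(7) that by (metis mult_mat_zero_vec)
  qed
  have T_semisimple: "T *\<^sub>v v = 0\<^sub>v n" if v: "v \<in> carrier_vec n" and "T *\<^sub>v (T *\<^sub>v v) = 0\<^sub>v n" for v
  proof -
    have "D *\<^sub>v (D *\<^sub>v (P *\<^sub>v v)) = P *\<^sub>v (T *\<^sub>v (T *\<^sub>v v))"
      using PT v T by (metis mult_mat_vec_carrier)
    then have "D *\<^sub>v (P *\<^sub>v v) = 0\<^sub>v n"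
      using semisimple[of "P *\<^sub>v v"] that PB(6) unfolding D_def by (simp add: mult_mat_zero_vec)
    then show ?thesis
      using P_inj PT v T by (metis mult_mat_vec_carrier)
  qed
  have T0: "T $$ (i, j) = 0" if "j \<le> i" "i < n" for i j
    using that ut PB(5) diag[of "B $$ (i, i)"]
    by (cases "i = j") (auto simp: T_def upper_triangular_def diag_mat_def)
  have col0: "col T j = 0\<^sub>v n" if "j < n" for j
    using that
  proof (induction j rule: less_induct)
    case (less j)
    have Tc: "T *\<^sub>v unit_vec n j = col T j"
      using T less.prems by (simp add: mult_mat_unit_vec)
    have "T *\<^sub>v col T j = 0\<^sub>v n"
    proof (rule eq_vecI)
      fix k assume k: "k < dim_vec (0\<^sub>v n :: 'a vec)"
      \<comment> \<open>One factor always vanishes: the first for \<open>i < j\<close>, by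
        induction, and the second for \<open>j \<le> i\<close>, by strict triangularity.\<close>
      have "T $$ (k, i) * T $$ (i, j) = 0" if "i < n" for i
      proof (cases "i < j")
        case True
        then have "col T i $ k = 0"
          using less.IH[of i] less.prems k by simp
        then show ?thesis
          using T k that by simp
      qed (use T0 that in auto)
      then show "(T *\<^sub>v col T j) $ k = 0\<^sub>v n $ k"
        using T k less.prems by (auto simp: scalar_prod_def)
    qed (use T in simp)
    then show ?case
      using T_semisimple[of "unit_vec n j"] Tc by simp
  qed
  have "B = 1\<^sub>m n"
  proof (rule eq_matI)
    fix i j assume ij: "i < dim_row (1\<^sub>m n :: 'a mat)" "j < dim_col (1\<^sub>m n :: 'a mat)"
    have "col T j $ i = 0"
      using col0 ij by simp
    then show "B $$ (i, j) = 1\<^sub>m n $$ (i, j)"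
      using ij T PB(5) by (simp add: T_def)
  qed (use PB(5) in auto)
  then show ?thesis
    using PB by simp
qed

section \<open>Monotonicity of the determinant and its rigidity\<close>

lemma det_mono_hermitian:
  fixes H Q :: "complex mat"
  assumes H: "H \<in> carrier_mat n n" and Q: "Q \<in> carrier_mat n n"
    and pos: "\<And>v. v \<in> carrier_vec n \<Longrightarrow> v \<noteq> 0\<^sub>v n \<Longrightarrow> 0 < (Q *\<^sub>v v) \<bullet>c v"
    and nonneg: "\<And>v. v \<in> carrier_vec n \<Longrightarrow> 0 \<le> (H *\<^sub>v v) \<bullet>c v"
    and le: "\<And>v. v \<in> carrier_vec n \<Longrightarrow> (H *\<^sub>v v) \<bullet>c v \<le> (Q *\<^sub>v v) \<bullet>c v"
  shows "det H \<le> det Q"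
    and "mat_adjoint H = H \<Longrightarrow> mat_adjoint Q = Q \<Longrightarrow> det H = det Q \<Longrightarrow> H = Q"
proof -
  have detQ: "0 < det Q"
    by (rule det_pos[OF Q pos])
  then obtain S where S: "S \<in> carrier_mat n n" "Q * S = 1\<^sub>m n"
    using det_non_zero_imp_unit[OF Q, of "()"] unfolding Units_def ring_mat_def by fastforce
  \<comment> \<open>\<open>N\<close> is \<open>Q\<^sup>-\<^sup>1 H\<close>. As
    \<open>det H = det Q * det N\<close>, both claims reduce to the eigenvalues of
    \<open>N\<close>.\<close>
  define N where "N = S * H"
  have N: "N \<in> carrier_mat n n" and QN: "Q * N = H"
    unfolding N_def using S H Q by (simp_all flip: assoc_mult_mat)
  have detH: "det H = det Q * det N"
    using det_mult[OF Q N] QN by simp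
  obtain B P P' where B: "similar_mat_wit N B P P'" "upper_triangular B"
    "\<And>e. e \<in> set (diag_mat B) \<Longrightarrow> eigenvalue N e" "det N = prod_list (diag_mat B)"
    using complex_triangularization[OF N] by metis
  \<comment> \<open>At an eigenvector, \<open>e\<close> times the positive value of \<open>Q\<close>
    is the value of \<open>H\<close>, which lies between \<open>0\<close> and the value of
    \<open>Q\<close>.\<close>
  have "0 \<le> e \<and> e \<le> 1" if e: "eigenvalue N e" for e
  proof -
    obtain v where v: "v \<in> carrier_vec n" "v \<noteq> 0\<^sub>v n"
      "(H *\<^sub>v v) \<bullet>c v = e * ((Q *\<^sub>v v) \<bullet>c v)"
      using eigenvalue_hermitian_form[OF H Q N QN e] by auto
    then show ?thesis
      using pos[of v] nonneg[of v] le[of v]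
      by (auto simp: less_complex_def less_eq_complex_def zero_le_mult_iff)
  qed
  then have detN: "0 \<le> det N" "det N \<le> 1"
    "det N = 1 \<Longrightarrow> e \<in> set (diag_mat B) \<Longrightarrow> e = 1" for e
    using prod_list_complex_le_1[of "diag_mat B"] B(3,4) by auto
  then show "det H \<le> det Q"
    unfolding detH using mult_left_mono[of "det N" 1 "det Q"] detQ by simp
  assume adj: "mat_adjoint H = H" "mat_adjoint Q = Q" and "det H = det Q"
  then have "det N = 1"
    using detH detQ by auto
  \<comment> \<open>\<open>N - 1\<close> is self-adjoint for the form \<open>Q\<close>, since
    \<open>Q (N - 1) = H - Q\<close> is hermitian. So for \<open>u = (N - 1) w\<close> the value of
    \<open>Q\<close> at \<open>u\<close> is conjugate to the pairing of \<open>Q ((N - 1) u)\<close>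
    with \<open>w\<close>, which is \<open>0\<close>; positivity of \<open>Q\<close> forces
    \<open>u = 0\<close>.\<close>
  moreover have "(N - 1\<^sub>m n) *\<^sub>v w = 0\<^sub>v n"
    if w: "w \<in> carrier_vec n" and 0: "(N - 1\<^sub>m n) *\<^sub>v ((N - 1\<^sub>m n) *\<^sub>v w) = 0\<^sub>v n" for w
  proof (rule ccontr)
    define u where "u = (N - 1\<^sub>m n) *\<^sub>v w"
    have u: "u \<in> carrier_vec n"
      unfolding u_def by (rule mult_mat_vec_carrier[OF minus_carrier_mat[OF one_carrier_mat] w])
    have form: "(Q *\<^sub>v ((N - 1\<^sub>m n) *\<^sub>v x)) \<bullet>c y = (H *\<^sub>v x) \<bullet>c y - (Q *\<^sub>v x) \<bullet>c y"
      if x: "x \<in> carrier_vec n" and y: "y \<in> carrier_vec n" for x y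
    proof -
      have "Q *\<^sub>v ((N - 1\<^sub>m n) *\<^sub>v x) = Q *\<^sub>v (N *\<^sub>v x) - Q *\<^sub>v x"
        using N Q x by (simp add: minus_mult_distrib_mat_vec[of _ n n] mult_minus_distrib_mat_vec[of _ n n])
      also have "Q *\<^sub>v (N *\<^sub>v x) = H *\<^sub>v x"
        using QN N Q x by (metis assoc_mult_mat_vec)
      finally show ?thesis
        using H Q x y by (simp add: minus_scalar_prod_distrib[of _ n])
    qed
    have "(Q *\<^sub>v u) \<bullet>c u = (H *\<^sub>v w) \<bullet>c u - (Q *\<^sub>v w) \<bullet>c u"
      using form[OF w u] by (simp add: u_def)
    also have "\<dots> = cnj ((H *\<^sub>v u) \<bullet>c w - (Q *\<^sub>v u) \<bullet>c w)"
      using hermitian_form_swap[OF H adj(1) w u] hermitian_form_swap[OF Q adj(2) w u] by simp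
    also have "(H *\<^sub>v u) \<bullet>c w - (Q *\<^sub>v u) \<bullet>c w = (Q *\<^sub>v 0\<^sub>v n) \<bullet>c w"
      using form[OF u w] 0 by (simp add: u_def)
    also have "\<dots> = 0"
      using Q w by (simp add: mult_mat_zero_vec)
    finally have "(Q *\<^sub>v u) \<bullet>c u = 0" by simp
    moreover assume "(N - 1\<^sub>m n) *\<^sub>v w \<noteq> 0\<^sub>v n"
    ultimately show False
      using pos[OF u] by (simp add: u_def)
  qed
  ultimately have "N = 1\<^sub>m n"
    using semisimple_unipotent[OF N B(1,2)] detN(3) by blast
  then show "H = Q"
    using QN Q by simp
qed

section \<open>Gram matrices and their determinants\<close>

lemma gram_form:
  fixes A B M :: "'a :: conjugatable_field mat"
  assumes A: "A \<in> carrier_mat m n" and B: "B \<in> carrier_mat m k" and M: "M \<in> carrier_mat m m"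
    and v: "v \<in> carrier_vec k" and w: "w \<in> carrier_vec n"
  shows "((mat_adjoint A * M * B) *\<^sub>v v) \<bullet>c w = (M *\<^sub>v (B *\<^sub>v v)) \<bullet>c (A *\<^sub>v w)"
proof -
  have "(mat_adjoint A * M * B) *\<^sub>v v = mat_adjoint A *\<^sub>v (M *\<^sub>v (B *\<^sub>v v))"
    using assoc_mult_mat_vec[OF mult_carrier_mat[OF mat_adjoint_carrier[OF A] M] B v]
      assoc_mult_mat_vec[OF mat_adjoint_carrier[OF A] M mult_mat_vec_carrier[OF B v]] by simp
  then show ?thesis
    using mat_adjoint_mult_vec_cscalar_prod[OF A _ w] B M v by simp
qed

lemma mat_adjoint_gram:
  fixes A B M :: "'a :: conjugatable_field mat"
  assumes A: "A \<in> carrier_mat m n" and B: "B \<in> carrier_mat m k" and M: "M \<in> carrier_mat m m"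
    and "mat_adjoint M = M"
  shows "mat_adjoint (mat_adjoint A * M * B) = mat_adjoint B * M * A"
  using assms
  by (simp add: mat_adjoint_mult[OF mult_carrier_mat[OF mat_adjoint_carrier[OF A] M] B]
      mat_adjoint_mult[OF mat_adjoint_carrier[OF A] M]
      assoc_mult_mat[OF mat_adjoint_carrier[OF B] M A])

text \<open>Reassociation exposes \<open>mat_adjoint X * (mat_adjoint A * M * B) * Y\<close>, a
  product of square matrices. This tracks the Gram determinant when columns are recombined.\<close>

lemma det_gram_mult:
  fixes A B M X Y :: "complex mat"
  assumes A: "A \<in> carrier_mat m n" and B: "B \<in> carrier_mat m n" and M: "M \<in> carrier_mat m m"
    and X: "X \<in> carrier_mat n n" and Y: "Y \<in> carrier_mat n n"
  shows "det (mat_adjoint (A * X) * M * (B * Y))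
    = cnj (det X) * det (mat_adjoint A * M * B) * det Y"
proof -
  note A' = mat_adjoint_carrier[OF A] and X' = mat_adjoint_carrier[OF X]
  note AM = mult_carrier_mat[OF A' M]
  have "mat_adjoint (A * X) * M * (B * Y)
      = mat_adjoint X * (mat_adjoint A * M * B) * Y"
    unfolding mat_adjoint_mult[OF A X] assoc_mult_mat[OF X' A' M]
      assoc_mult_mat[OF X' AM B, symmetric]
      assoc_mult_mat[OF mult_carrier_mat[OF X' AM] B Y] ..
  then show ?thesis
    using det_mult[OF mult_carrier_mat[OF X' mult_carrier_mat[OF AM B]] Y]
      det_mult[OF X' mult_carrier_mat[OF AM B]] det_mat_adjoint[OF X] by simp
qed

context
  fixes m :: nat and M :: "complex mat"
  assumes M: "hermitian_pos_def m M"
begin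

private lemma M_facts:
  "M \<in> carrier_mat m m" "mat_adjoint M = M"
  "v \<in> carrier_vec m \<Longrightarrow> v \<noteq> 0\<^sub>v m \<Longrightarrow> 0 < (M *\<^sub>v v) \<bullet>c v"
  using M by (auto simp: hermitian_pos_def_def hermitian_mat_def)

private lemma form_nonneg:
  assumes "v \<in> carrier_vec m"
  shows "0 \<le> (M *\<^sub>v v) \<bullet>c v"
proof (cases "v = 0\<^sub>v m")
  case True
  then show ?thesis
    using M_facts(1) by (simp add: mult_mat_zero_vec)
qed (use M_facts(3)[of v] assms in simp)

text \<open>The two Gram matrices are adjoint to each other. This exchanges \<open>A\<close> and
  \<open>B\<close>, so that a rank defect of the left factor can be treated like one of the right
  factor.\<close>

lemma cnj_det_gram:
  assumes A: "A \<in> carrier_mat m n" and B: "B \<in> carrier_mat m n"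
  shows "det (mat_adjoint B * M * A) = cnj (det (mat_adjoint A * M * B))"
proof -
  have "mat_adjoint A * M * B \<in> carrier_mat n n"
    using mult_carrier_mat[OF mult_carrier_mat[OF mat_adjoint_carrier[OF A] M_facts(1)] B] .
  then show ?thesis
    using det_mat_adjoint[of "mat_adjoint A * M * B" n]
      mat_adjoint_gram[OF A B M_facts(1,2)] by simp
qed

text \<open>A nonzero kernel vector of \<open>B\<close> also lies in the kernel of the Gram
  matrix.\<close>

lemma det_gram_eq_0:
  assumes A: "A \<in> carrier_mat m n" and B: "B \<in> carrier_mat m n" and "vec_space.rank m B < n"
  shows "det (mat_adjoint A * M * B) = 0"
proof -
  obtain v where v: "v \<in> carrier_vec n" "v \<noteq> 0\<^sub>v n" "B *\<^sub>v v = 0\<^sub>v m"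
    using assms rank_less_iff_kernel[OF B] by auto
  have AM: "mat_adjoint A * M \<in> carrier_mat n m"
    using mult_carrier_mat[OF mat_adjoint_carrier[OF A] M_facts(1)] .
  then have "(mat_adjoint A * M * B) *\<^sub>v v = 0\<^sub>v n"
    using B v by (simp add: assoc_mult_mat_vec[of _ n m _ n] mult_mat_zero_vec)
  then show ?thesis
    using det_0_iff_vec_prod_zero[of "mat_adjoint A * M * B" n] AM B v by auto
qed

text \<open>Full column rank makes \<open>B\<close> injective, so \<open>v\<close> is sent to a
  nonzero vector, where \<open>M\<close> is positive.\<close>

lemma gram_pos_def:
  assumes B: "B \<in> carrier_mat m n" and "vec_space.rank m B = n"
    and v: "v \<in> carrier_vec n" "v \<noteq> 0\<^sub>v n"
  shows "0 < ((mat_adjoint B * M * B) *\<^sub>v v) \<bullet>c v"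
proof -
  have "B *\<^sub>v v \<noteq> 0\<^sub>v m"
    using assms rank_less_iff_kernel[OF B] by auto
  then show ?thesis
    using gram_form[OF B B M_facts(1) v(1) v(1)] M_facts(3)[of "B *\<^sub>v v"] B v by simp
qed

lemma det_gram_pos:
  assumes B: "B \<in> carrier_mat m n" and "vec_space.rank m B = n"
  shows "0 < det (mat_adjoint B * M * B)"
  using det_pos[OF mult_carrier_mat[OF mult_carrier_mat[OF mat_adjoint_carrier[OF B] M_facts(1)] B]]
    gram_pos_def[OF assms] by blast

section \<open>Full column rank: the inequality and its equality case\<close>

lemma gram_det_inequality:
  assumes A: "A \<in> carrier_mat m n" and B: "B \<in> carrier_mat m n"
    and rA: "vec_space.rank m A = n" and rB: "vec_space.rank m B = n"
  defines "c \<equiv> complex_of_real ((cmod (det (mat_adjoint A * M * B)))\<^sup>2)"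
    and "d \<equiv> det (mat_adjoint A * M * A) * det (mat_adjoint B * M * B)"
  shows "c \<le> d" and "c = d \<longleftrightarrow> vec_space.col_space m A = vec_space.col_space m B"
proof -
  note Mc = M_facts(1)
  define P C Q where "P = mat_adjoint A * M * A" and "C = mat_adjoint A * M * B"
    and "Q = mat_adjoint B * M * B"
  have P: "P \<in> carrier_mat n n" and C: "C \<in> carrier_mat n n" and Q: "Q \<in> carrier_mat n n"
    unfolding P_def C_def Q_def using A B Mc by auto
  have detP: "0 < det P" and detQ: "0 < det Q"
    unfolding P_def Q_def using det_gram_pos[OF A rA] det_gram_pos[OF B rB] by simp_all
  have cnjP: "cnj (det P) = det P"
    using detP by (simp add: less_complex_def complex_eq_iff)
  have c: "c = det C * cnj (det C)" and d: "d = det P * det Q"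
    unfolding c_def d_def P_def C_def Q_def complex_norm_square by simp_all
  have full: "\<exists>S \<in> carrier_mat n n. Z * S = 1\<^sub>m n"
    if "Z \<in> carrier_mat n n" "det Z \<noteq> 0" for Z :: "complex mat"
    using det_non_zero_imp_unit[OF that, of "()"] unfolding Units_def ring_mat_def by auto
  have "det P \<noteq> 0"
    using detP by auto
  then obtain S where S: "S \<in> carrier_mat n n" "P * S = 1\<^sub>m n"
    using full[OF P] by blast
  \<comment> \<open>\<open>X\<close> solves the normal equations \<open>P X = C\<close>, with
    \<open>S\<close> the inverse of \<open>P\<close>.\<close>
  define X where "X = S * C"
  have X: "X \<in> carrier_mat n n" and PX: "P * X = C"
    unfolding X_def using S P C by (simp_all flip: assoc_mult_mat)
  have detC: "det C = det P * det X"
    using det_mult[OF P X] PX by simp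
  define H where "H = mat_adjoint (A * X) * M * (A * X)"
  have AX: "A * X \<in> carrier_mat m n" and H: "H \<in> carrier_mat n n"
    unfolding H_def using A X Mc by auto
  have "det H = cnj (det X) * det P * det X"
    unfolding H_def P_def by (rule det_gram_mult[OF A A Mc X X])
  \<comment> \<open>As \<open>det P\<close> is real, both sides equal \<open>(det P)^2\<close> times
    the squared modulus of \<open>det X\<close>. Cancelling \<open>det P\<close> reduces
    \<open>c\<close> against \<open>d\<close> to \<open>det H\<close> against
    \<open>det Q\<close>.\<close>
  then have cH: "c = det P * det H"
    unfolding c detC using cnjP by simp
  \<comment> \<open>The residual \<open>r = b - a\<close> is \<open>M\<close>-orthogonal to
    \<open>a\<close>: the pairings of \<open>M b\<close> and of \<open>M a\<close> with
    \<open>a\<close> agree because \<open>P X = C\<close>. So the mixed terms in the expansion of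
    \<open>b = a + r\<close> vanish.\<close>
  have pythagoras: "(Q *\<^sub>v v) \<bullet>c v
      = (H *\<^sub>v v) \<bullet>c v + (M *\<^sub>v (B *\<^sub>v v - (A * X) *\<^sub>v v)) \<bullet>c (B *\<^sub>v v - (A * X) *\<^sub>v v)"
    if v: "v \<in> carrier_vec n" for v
  proof -
    define a b r where "a = (A * X) *\<^sub>v v" and "b = B *\<^sub>v v" and "r = b - a"
    have abr: "a \<in> carrier_vec m" "b \<in> carrier_vec m" "r \<in> carrier_vec m"
      unfolding r_def a_def b_def using AX B v by auto
    have a: "a = A *\<^sub>v (X *\<^sub>v v)"
      unfolding a_def using A X v by (simp add: assoc_mult_mat_vec)
    have Xv: "X *\<^sub>v v \<in> carrier_vec n"
      using X v by simp
    have "(M *\<^sub>v r) \<bullet>c a = (M *\<^sub>v b) \<bullet>c a - (M *\<^sub>v a) \<bullet>c a"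
      unfolding r_def using abr Mc
      by (simp add: mult_minus_distrib_mat_vec[of _ m m] minus_scalar_prod_distrib[of _ m])
    also have "(M *\<^sub>v b) \<bullet>c a = (C *\<^sub>v v) \<bullet>c (X *\<^sub>v v)"
      unfolding b_def a C_def using gram_form[OF A B Mc v Xv] by simp
    also have "(M *\<^sub>v a) \<bullet>c a = (P *\<^sub>v (X *\<^sub>v v)) \<bullet>c (X *\<^sub>v v)"
      unfolding a P_def using gram_form[OF A A Mc Xv Xv] by simp
    also have "P *\<^sub>v (X *\<^sub>v v) = C *\<^sub>v v"
      using PX assoc_mult_mat_vec[OF P X v] by simp
    finally have ra: "(M *\<^sub>v r) \<bullet>c a = 0"
      by simp
    then have ar: "(M *\<^sub>v a) \<bullet>c r = 0"
      using hermitian_form_swap[OF Mc M_facts(2) abr(1,3)] by simp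
    have "b = a + r"
      unfolding r_def using abr(1,2) by auto
    then have "(M *\<^sub>v b) \<bullet>c b
        = (M *\<^sub>v a) \<bullet>c a + (M *\<^sub>v r) \<bullet>c a + ((M *\<^sub>v a) \<bullet>c r + (M *\<^sub>v r) \<bullet>c r)"
      using abr Mc
      by (simp add: mult_add_distrib_mat_vec[of _ m m] conjugate_add_vec[of _ m]
          add_scalar_prod_distrib[of _ m] scalar_prod_add_distrib[of _ m])
    moreover have "(Q *\<^sub>v v) \<bullet>c v = (M *\<^sub>v b) \<bullet>c b" "(H *\<^sub>v v) \<bullet>c v = (M *\<^sub>v a) \<bullet>c a"
      unfolding Q_def H_def a_def b_def
      using gram_form[OF B B Mc v v] gram_form[OF AX AX Mc v v] by simp_all
    ultimately show ?thesis
      using ra ar by (simp add: r_def a_def b_def)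
  qed
  have Qpos: "0 < (Q *\<^sub>v v) \<bullet>c v" if "v \<in> carrier_vec n" "v \<noteq> 0\<^sub>v n" for v
    unfolding Q_def using gram_pos_def[OF B rB that] .
  have Hnonneg: "0 \<le> (H *\<^sub>v v) \<bullet>c v" if v: "v \<in> carrier_vec n" for v
    unfolding H_def gram_form[OF AX AX Mc v v] using form_nonneg AX v by simp
  have HQ: "(H *\<^sub>v v) \<bullet>c v \<le> (Q *\<^sub>v v) \<bullet>c v" if v: "v \<in> carrier_vec n" for v
    unfolding pythagoras[OF v] using form_nonneg AX B v by simp
  note mono = det_mono_hermitian[OF H Q Qpos Hnonneg HQ]
  show "c \<le> d"
    unfolding cH d using mono(1) detP by (simp add: mult_left_mono)
  have col_space: "vec_space.col_space m Z = {Z *\<^sub>v x | x. x \<in> carrier_vec n}"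
    if "Z \<in> carrier_mat m n" for Z :: "complex mat"
    using vec_space.col_space_eq[OF that] that by auto
  show "c = d \<longleftrightarrow> vec_space.col_space m A = vec_space.col_space m B"
  proof
    assume "c = d"
    then have "det H = det Q"
      unfolding cH d using detP by auto
    then have "H = Q"
      using mono(2) mat_adjoint_gram[OF AX AX Mc M_facts(2)] mat_adjoint_gram[OF B B Mc M_facts(2)]
      unfolding H_def Q_def by simp
    \<comment> \<open>With \<open>H = Q\<close> the residual term in \<open>pythagoras\<close> is
      \<open>0\<close>, and positivity of \<open>M\<close> makes the residual itself vanish.\<close>
    have BX: "B *\<^sub>v v = A *\<^sub>v (X *\<^sub>v v)" if v: "v \<in> carrier_vec n" for v
    proof -
      define r where "r = B *\<^sub>v v - (A * X) *\<^sub>v v"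
      have r: "r \<in> carrier_vec m" and "(M *\<^sub>v r) \<bullet>c r = 0"
        using pythagoras[OF v] \<open>H = Q\<close> AX B v unfolding r_def by auto
      then have r0: "r = 0\<^sub>v m"
        using M_facts(3)[of r] by auto
      have "y = y - x + x" if "x \<in> carrier_vec m" "y \<in> carrier_vec m" for x y :: "complex vec"
        using that by auto
      then have "B *\<^sub>v v = r + (A * X) *\<^sub>v v"
        unfolding r_def using mult_mat_vec_carrier[OF AX v] mult_mat_vec_carrier[OF B v] by blast
      then show ?thesis
        using r0 A X v AX by (simp add: assoc_mult_mat_vec)
    qed
    \<comment> \<open>\<open>B = A X\<close> yields only one inclusion of the column spaces. The
      other needs \<open>X\<close> invertible: \<open>c = d\<close> is nonzero and
      \<open>det X\<close> is a factor of \<open>det C\<close>.\<close>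
    have "d \<noteq> 0"
      unfolding d using detP detQ by auto
    then have "det X \<noteq> 0"
      using \<open>c = d\<close> unfolding c detC by auto
    then obtain Y where Y: "Y \<in> carrier_mat n n" "X * Y = 1\<^sub>m n"
      using full[OF X] by blast
    have AY: "A *\<^sub>v v = B *\<^sub>v (Y *\<^sub>v v)" if v: "v \<in> carrier_vec n" for v
      using BX[of "Y *\<^sub>v v"] Y X v by (simp flip: assoc_mult_mat_vec)
    show "vec_space.col_space m A = vec_space.col_space m B"
      unfolding col_space[OF A] col_space[OF B]
    proof safe
      fix x :: "complex vec" assume x: "x \<in> carrier_vec n"
      show "\<exists>y. A *\<^sub>v x = B *\<^sub>v y \<and> y \<in> carrier_vec n"
        using AY[OF x] Y x by (intro exI[of _ "Y *\<^sub>v x"]) simp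
      show "\<exists>y. B *\<^sub>v x = A *\<^sub>v y \<and> y \<in> carrier_vec n"
        using BX[OF x] X x by (intro exI[of _ "X *\<^sub>v x"]) simp
    qed
  next
    \<comment> \<open>Each column of \<open>B\<close> is some \<open>A u\<close>; collecting these
      \<open>u\<close> as the columns of \<open>Y\<close> gives \<open>B = A Y\<close>. Then
      \<open>c\<close> and \<open>d\<close> both equal \<open>(det P)^2\<close> times the squared
      modulus of \<open>det Y\<close>.\<close>
    assume eq: "vec_space.col_space m A = vec_space.col_space m B"
    have "\<exists>u \<in> carrier_vec n. A *\<^sub>v u = col B j" if j: "j < n" for j
    proof -
      have "col B j \<in> vec_space.col_space m B"
        unfolding col_space[OF B] using mult_mat_unit_vec[OF B j]
        by (metis (mono_tags, lifting) mem_Collect_eq unit_vec_carrier)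
      then show ?thesis
        unfolding eq[symmetric] col_space[OF A] by auto
    qed
    then obtain u where u: "\<And>j. j < n \<Longrightarrow> u j \<in> carrier_vec n \<and> A *\<^sub>v u j = col B j"
      by metis
    define Y where "Y = mat_of_cols n (map u [0..<n])"
    have Y: "Y \<in> carrier_mat n n"
      unfolding Y_def using mat_of_cols_carrier(1)[of n "map u [0..<n]"] by simp
    have "A * Y = B"
    proof (rule mat_col_eqI)
      fix j assume "j < dim_col B"
      then have j: "j < n"
        using B by simp
      have "col Y j = u j"
        unfolding Y_def using u[OF j] j by (subst col_mat_of_cols) auto
      then show "col (A * Y) j = col B j"
        using col_mult2[OF A Y j] u[OF j] by simp
    qed (use A B Y in auto)
    then have "det C = det P * det Y" "det Q = cnj (det Y) * det P * det Y"
      using det_gram_mult[OF A A Mc one_carrier_mat Y] det_gram_mult[OF A A Mc Y Y] A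
      unfolding C_def P_def Q_def by simp_all
    then show "c = d"
      unfolding c d using cnjP by simp
  qed
qed

end

section \<open>Cases by shape and rank\<close>

theorem theorem3:
  fixes m n :: nat and A B M :: "complex mat"
  assumes "0 < m" and "0 < n"
    and "A \<in> carrier_mat m n" and "B \<in> carrier_mat m n"
    and "hermitian_pos_def m M"
  shows
    "complex_of_real ((cmod (det (mat_adjoint A * M * B)))\<^sup>2)
       \<le> det (mat_adjoint A * M * A) * det (mat_adjoint B * M * B) \<and>
     (m < n \<longrightarrow>
       complex_of_real ((cmod (det (mat_adjoint A * M * B)))\<^sup>2) = 0 \<and>
       det (mat_adjoint A * M * A) * det (mat_adjoint B * M * B) = 0) \<and>
     (m = n \<longrightarrow>
       complex_of_real ((cmod (det (mat_adjoint A * M * B)))\<^sup>2)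
         = det (mat_adjoint A * M * A) * det (mat_adjoint B * M * B)) \<and>
     (m > n \<and> (vec_space.rank m A < n \<or> vec_space.rank m B < n) \<longrightarrow>
       complex_of_real ((cmod (det (mat_adjoint A * M * B)))\<^sup>2) = 0 \<and>
       det (mat_adjoint A * M * A) * det (mat_adjoint B * M * B) = 0) \<and>
     (m > n \<and> vec_space.rank m A = n \<and> vec_space.rank m B = n \<longrightarrow>
       (complex_of_real ((cmod (det (mat_adjoint A * M * B)))\<^sup>2)
          = det (mat_adjoint A * M * A) * det (mat_adjoint B * M * B)
        \<longleftrightarrow> vec_space.col_space m A = vec_space.col_space m B))"
    (is "?c \<le> ?d \<and> _")
proof -
  note A = assms(3) and B = assms(4) and M = assms(5)
  \<comment> \<open>A rank defect of \<open>A\<close> or \<open>B\<close> kills one factor of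
    \<open>?d\<close>. It also kills the mixed determinant, directly for \<open>B\<close> and by
    conjugation for \<open>A\<close>.\<close>
  have degenerate: "?c = 0 \<and> ?d = 0" if "vec_space.rank m A < n \<or> vec_space.rank m B < n"
    using that det_gram_eq_0[OF M A A] det_gram_eq_0[OF M A B] det_gram_eq_0[OF M B A]
      det_gram_eq_0[OF M B B] cnj_det_gram[OF M A B] by auto
  have "vec_space.rank m A = n \<and> vec_space.rank m B = n"
    if "\<not> (vec_space.rank m A < n \<or> vec_space.rank m B < n)"
    using that vec_space.rank_le_nc[OF A] vec_space.rank_le_nc[OF B] by simp
  then have le: "?c \<le> ?d"
    using degenerate gram_det_inequality(1)[OF M A B] by fastforce
  \<comment> \<open>The rank is at most the number of rows, so a wide matrix falls under
    \<open>degenerate\<close>.\<close>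
  have wide: "vec_space.rank m A < n" if "m < n"
    using rank_le_dim[OF A] that by simp
  \<comment> \<open>For square matrices the determinants factor completely, also when
    \<open>A\<close> or \<open>B\<close> is singular. Since \<open>det M\<close> is real, both sides
    are \<open>(det M)^2\<close> times the squared moduli of \<open>det A\<close> and
    \<open>det B\<close>.\<close>
  have square: "?c = ?d" if "m = n"
  proof -
    have Mc: "M \<in> carrier_mat m m" and "mat_adjoint M = M"
      using M by (auto simp: hermitian_pos_def_def hermitian_mat_def)
    then have "cnj (det M) = det M"
      using det_mat_adjoint by metis
    moreover have "det (mat_adjoint X * M * Y) = cnj (det X) * det M * det Y"
      if "X \<in> carrier_mat m m" "Y \<in> carrier_mat m m" for X Y
      using det_mult[OF mult_carrier_mat[OF mat_adjoint_carrier[OF that(1)] Mc] that(2)]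
        det_mult[OF mat_adjoint_carrier[OF that(1)] Mc] det_mat_adjoint[OF that(1)] by simp
    ultimately show ?thesis
      using A B that unfolding complex_norm_square by simp
  qed
  show ?thesis
    using le degenerate wide square gram_det_inequality(2)[OF M A B] by auto
qed

end
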